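(* Let $N$ be a positive integer and let $W_1(x)=\frac1N\bigl\langle\mathrm{tr}\frac{1}{x-H}\bigr\rangle$ be the normalized one-loop correlation function of the generalized Laguerre ensemble of $N\times N$ matrices with weight $\det(H)\,e^{-N\mathrm{tr}H}$, regarded as a formal power series in $1/x$. Then $W_1(x)$ satisfies the inhomogeneous differential equation $$\begin{aligned}&\Bigl[ N^2 \Bigl((-2x^2+8x)\frac{\partial}{\partial x}+4\Bigr)+N \Bigl((-x^2+8x)\frac{\partial}{\partial x}+4\Bigr)\\&\quad+\Bigl(2x^2 \frac{\partial^3}{\partial x^3} +(-x^2+12x)\frac{\partial^2}{\partial x^2}+(-x+12)\frac{\partial}{\partial x} +1\Bigr)\\&\quad+N^{-1}\Bigl( x^2\frac{\partial^3}{\partial x^3}+6x\frac{\partial^2}{\partial x^2}+6\frac{\partial}{\partial x}\Bigr)+N^{-2}\Bigl( x^2\frac{\partial^4}{\partial x^4}+7x\frac{\partial^3}{\partial x^3}+9\frac{\partial^2}{\partial x^2}\Bigr)\Bigr] W_1(x)\\&=2N^2+N+\frac{2N+2}{x}.\end{aligned}$$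
   Context: The generalized Laguerre ensemble with weight $\det(H)e^{-N\mathrm{tr}H}$: the eigenvalues $\lambda_1,\dots,\lambda_N\in[0,\infty)$ of the positive-definite Hermitian $N\times N$ matrix $H$ have joint probability density proportional to $\prod_{i<j}(\lambda_i-\lambda_j)^2\prod_i\lambda_i e^{-N\lambda_i}$; $\langle\cdot\rangle$ is the expectation. Equivalently $H=BB^\dagger$, where $B$ is an $N\times(N+1)$ complex matrix with density proportional to $e^{-N\mathrm{tr}BB^\dagger}$. The formal series is $W_1(x)=\sum_{n\ge0}\frac1N\langle\mathrm{tr}\,H^n\rangle x^{-n-1}$, so $W_1(x)=\frac1x+(1+\frac1N)\frac1{x^2}+\cdots$. *)

theory Defs
  imports
    "HOL-Probability.Probability"
    "HOL-Computational_Algebra.Formal_Laurent_Series"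
    "Jordan_Normal_Form.Char_Poly"
    "Jordan_Normal_Form.Schur_Decomposition"
begin

definition mat_trace :: "complex mat \<Rightarrow> complex" where
  "mat_trace A = (\<Sum>i<dim_row A. A $$ (i, i))"

definition positive_definite_mat :: "complex mat \<Rightarrow> bool" where
  "positive_definite_mat A \<longleftrightarrow>
     mat_adjoint A = A \<and>
     (\<forall>v \<in> carrier_vec (dim_row A). v \<noteq> 0\<^sub>v (dim_row A) \<longrightarrow> Re ((A *\<^sub>v v) \<bullet>c v) > 0)"

definition laguerre_weight :: "nat \<Rightarrow> (nat \<Rightarrow> real) \<Rightarrow> real" where
  "laguerre_weight N l =
     (if \<forall>i<N. 0 \<le> l i
      then (\<Prod>j<N. \<Prod>i<j. (l i - l j)\<^sup>2) * (\<Prod>i<N. l i * exp (- real N * l i))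
      else 0)"

text \<open>
  A random positive definite Hermitian matrix \<open>H\<close> on the probability space \<open>M\<close> whose eigenvalues,
  listed with algebraic multiplicity, have joint Lebesgue density on \<open>\<real>\<^sup>N\<close> proportional to the
  (symmetric) weight above.  The labels of the eigenvalues carry no order.  The constant \<open>c\<close> is
  determined by normalization of probability.
\<close>

definition laguerre_ensemble :: "nat \<Rightarrow> 'a measure \<Rightarrow> ('a \<Rightarrow> complex mat) \<Rightarrow> bool" where
  "laguerre_ensemble N M H \<longleftrightarrow>
     prob_space M \<and>
     (\<forall>\<omega> \<in> space M. H \<omega> \<in> carrier_mat N N) \<and>
     (\<forall>i<N. \<forall>j<N. (\<lambda>\<omega>. H \<omega> $$ (i, j)) \<in> borel_measurable M) \<and>
     (AE \<omega> in M. positive_definite_mat (H \<omega>)) \<and>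
     (\<exists>lam :: nat \<Rightarrow> 'a \<Rightarrow> real. \<exists>c :: real.
        (AE \<omega> in M. char_poly (H \<omega>) = (\<Prod>i<N. [:- complex_of_real (lam i \<omega>), 1:])) \<and>
        distributed M (Pi\<^sub>M {..<N} (\<lambda>_. lborel)) (\<lambda>\<omega>. \<lambda>i\<in>{..<N}. lam i \<omega>)
          (\<lambda>l. ennreal (c * laguerre_weight N l)))"

text \<open>
  Formal series in \<open>1/x\<close>, with finitely many positive powers of \<open>x\<close> allowed, are Laurent series in
  the indeterminate \<open>fls_X = 1/x\<close>.  Thus \<open>x\<close> itself is \<open>fls_X_inv\<close>, and by the chain rule
  \<open>\<partial>/\<partial>x = - t\<^sup>2 d/dt\<close> for \<open>t = 1/x\<close>.
\<close>

abbreviation ser_x :: "complex fls" where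
  "ser_x \<equiv> fls_X_inv"

definition ser_D :: "complex fls \<Rightarrow> complex fls" where
  "ser_D F = - (fls_X\<^sup>2 * fls_deriv F)"

lemma ser_D_nth: "fls_nth (ser_D F) (k + 1) = - of_int k * fls_nth F k"
  by (simp add: ser_D_def fls_X_power_times_conv_shift)

lemma ser_D_x: "ser_D ser_x = 1"
  by (rule fls_eqI) (use ser_D_nth[of ser_x "_ - 1"] in auto)

lemma ser_D_mult: "ser_D (F * G) = F * ser_D G + ser_D F * G"
  by (simp add: ser_D_def algebra_simps)

lemma inverse_ser_x: "1 / ser_x = fls_X"
  by (simp add: fls_inverse_X_inv divide_inverse)

text \<open>
  The series of \<open>(1/N) \<langle>tr 1/(x - H)\<rangle> = (1/N) (\<Sum>n. \<langle>tr H\<^sup>n\<rangle> x\<^bsup>-n-1\<^esup>)\<close>: the coefficient of \<open>x\<^bsup>-k\<^esup>\<close> is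
  the \<open>k\<close>-th one.
\<close>

definition W1 :: "nat \<Rightarrow> 'a measure \<Rightarrow> ('a \<Rightarrow> complex mat) \<Rightarrow> complex fls" where
  "W1 N M H = fls_X * fps_to_fls (Abs_fps (\<lambda>n.
     1 / of_nat N * (LINT \<omega>|M. mat_trace (H \<omega> ^\<^sub>m n))))"

end

(*
  Squaring the Vandermonde determinant, written in Laguerre polynomials, and integrating reduces
  the moments of the ensemble to sums of the integrals of x^n l_k(x)^2 against x e^(-x).
  Integration by parts and x l_k' = (k - 1) l_k - k l_(k-1), where l_k = L_(k-1)^(1), evaluate
  these sums in closed form as an integral of x^n l_(N+1) l_N.  The integrals of x^n times a
  product of l_N and l_(N+1) obey a first-order linear system in n; eliminating yields a three-term
  recurrence R_n = 0 for the moments.  The coefficient of x^(-n-1) in the differential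
  equation is (2 N^2 + N) R_n - (n - 1) R_(n-1).
*)
theory Submission
  imports Defs
begin

subsection \<open>Moments of the Laguerre polynomials\<close>

text \<open>The factor N in the exponent is only a rescaling, so the moments are computed for N H,
  whose weight x e^(-x) is the Laguerre weight of parameter 1. Two derivative formulas are
  available, one lowering and one raising the index. Applied to l_(N+1) and l_N respectively they
  stay within the span of these two, up to a term x l_N, so integration by parts closes on the
  integrals of x^n against l_(N+1)^2, l_(N+1) l_N and l_N^2. One of the relations obtained contains
  no x^(n+1): it leaves only two independent unknowns, which is why the elimination ends in three
  terms, and at n = 0 it already contains the orthogonality of the polynomials.\<close>

text \<open>The integral of \<open>p\<close> against x e^(-x) over the half line, where x^i
  contributes (i + 1)!. Being defined on coefficients, it reduces the theory of the moments to
  polynomial algebra.\<close>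

definition laguerre_functional :: "real poly \<Rightarrow> real" where
  "laguerre_functional p = (\<Sum>i\<le>degree p. coeff p i * fact (Suc i))"

lemma laguerre_functional_eq:
  assumes "degree p \<le> n"
  shows "laguerre_functional p = (\<Sum>i\<le>n. coeff p i * fact (Suc i))"
  unfolding laguerre_functional_def
  by (rule sum.mono_neutral_left) (use assms in \<open>auto simp: coeff_eq_0\<close>)

lemma laguerre_functional_add:
  "laguerre_functional (p + q) = laguerre_functional p + laguerre_functional q"
proof -
  define n where "n = max (degree p) (degree q)"
  have "degree (p + q) \<le> n" "degree p \<le> n" "degree q \<le> n"
    by (auto simp: n_def degree_add_le)
  then show ?thesis
    by (simp add: laguerre_functional_eq sum.distrib distrib_right)
qed

lemma laguerre_functional_smult:
  "laguerre_functional (Polynomial.smult c p) = c * laguerre_functional p"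
  by (subst laguerre_functional_eq[where n = "degree p"])
     (auto simp: laguerre_functional_def sum_distrib_left mult_ac degree_smult_le)

lemma laguerre_functional_diff:
  "laguerre_functional (p - q) = laguerre_functional p - laguerre_functional q"
  using laguerre_functional_add[of "p - q" q] by simp

lemma laguerre_functional_0 [simp]: "laguerre_functional 0 = 0"
  by (simp add: laguerre_functional_def)

lemma laguerre_functional_1 [simp]: "laguerre_functional 1 = 1"
  by (simp add: laguerre_functional_def)

lemmas laguerre_functional_linear =
  laguerre_functional_add laguerre_functional_smult laguerre_functional_diff

text \<open>Integration by parts against x^2 e^(-x), which vanishes at both ends of the half line
  and has derivative (2 - x) x e^(-x). On coefficients it is i (i + 1)! = (i + 2)! - 2 (i +
  1)!.\<close>

lemma laguerre_functional_pderiv: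
  "laguerre_functional ([:0, 1:] * pderiv p) =
     laguerre_functional ([:0, 1:] * p) - 2 * laguerre_functional p"
proof -
  define n where "n = degree p"
  have "laguerre_functional ([:0, 1:] * pderiv p) =
      (\<Sum>i\<le>Suc n. coeff ([:0, 1:] * pderiv p) i * fact (Suc i))"
    by (rule laguerre_functional_eq) (simp add: n_def degree_pderiv degree_pCons_le)
  also have "\<dots> = (\<Sum>i\<le>Suc n. of_nat i * coeff p i * fact (Suc i))"
    by (rule sum.cong) (auto simp: coeff_pCons coeff_pderiv split: nat.split)
  also have "\<dots> = (\<Sum>i\<le>n. of_nat i * coeff p i * fact (Suc i))"
    by (simp add: n_def coeff_eq_0)
  finally have lhs: "laguerre_functional ([:0, 1:] * pderiv p) = \<dots>" .
  have "laguerre_functional ([:0, 1:] * p) =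
      (\<Sum>i\<le>Suc n. coeff ([:0, 1:] * p) i * fact (Suc i))"
    by (rule laguerre_functional_eq) (simp add: n_def degree_pCons_le)
  also have "\<dots> = (\<Sum>i\<le>n. coeff p i * fact (Suc (Suc i)))"
    by (simp del: fact_Suc sum.atMost_Suc add: sum.atMost_Suc_shift)
  finally have rhs: "laguerre_functional ([:0, 1:] * p) = \<dots>" .
  have "laguerre_functional p = (\<Sum>i\<le>n. coeff p i * fact (Suc i))"
    by (simp add: laguerre_functional_def n_def)
  then show ?thesis
    unfolding lhs rhs by (simp only: sum_distrib_left sum_subtractf[symmetric])
      (rule sum.cong, simp_all add: algebra_simps)
qed

section \<open>Laguerre polynomials and their derivatives\<close>

text \<open>
  \<open>shifted_laguerre k\<close> is \<open>L\<^sub>k\<^sub>-\<^sub>1\<close> for the parameter \<open>\<alpha> = 1\<close>.  With this indexing the squared norm is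
  \<open>k\<close>, and \<open>shifted_laguerre 0 = 0\<close> absorbs the boundary cases of the recurrences.
\<close>

fun shifted_laguerre :: "nat \<Rightarrow> real poly" where
  "shifted_laguerre 0 = 0"
| "shifted_laguerre (Suc 0) = 1"
| "shifted_laguerre (Suc (Suc k)) =
     [:2, - 1 / real (Suc k):] * shifted_laguerre (Suc k) - shifted_laguerre k"

declare shifted_laguerre.simps(3) [simp del]

text \<open>Prepares the change of basis in the Vandermonde determinant: the bound makes the
  coefficient matrix triangular, the nonzero coefficient makes it invertible.\<close>

lemma degree_coeff_shifted_laguerre:
  "degree (shifted_laguerre (Suc k)) \<le> k \<and> coeff (shifted_laguerre (Suc k)) k \<noteq> 0"
proof (induction k rule: shifted_laguerre.induct)
  case (3 k)
  let ?p = "shifted_laguerre (Suc (Suc k))"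
  let ?q = "shifted_laguerre (Suc k)"
  have p: "degree ?p \<le> Suc k" "coeff ?p (Suc k) \<noteq> 0" and q: "degree ?q \<le> k"
    using 3 by auto
  have "degree ([:2, - 1 / real (Suc (Suc k)):] * ?p) \<le> Suc (Suc k)"
    using degree_mult_le[of "[:2, - 1 / real (Suc (Suc k)):]" ?p] p(1) by simp
  moreover have "coeff ?p (Suc (Suc k)) = 0" "coeff ?q (Suc (Suc k)) = 0"
    using p q by (auto intro: coeff_eq_0)
  moreover have "degree ?q \<le> Suc (Suc k)"
    using q by simp
  ultimately show ?case
    using p(2) unfolding shifted_laguerre.simps(3)[of "Suc k"]
    by (auto intro!: degree_diff_le)
qed (auto simp: shifted_laguerre.simps(3))

lemma poly_shifted_laguerre_Suc_Suc:
  "real (Suc k) * poly (shifted_laguerre (Suc (Suc k))) x =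
     (2 * real (Suc k) - x) * poly (shifted_laguerre (Suc k)) x
     - real (Suc k) * poly (shifted_laguerre k) x"
  by (simp add: shifted_laguerre.simps(3) field_simps)

text \<open>The lowering and the raising formula are proved together: the step for the first
  differentiates the recurrence and needs both. The second at \<open>Suc k\<close> is the first at
  \<open>k\<close> with l_k eliminated by the recurrence.\<close>

lemma poly_pderiv_shifted_laguerre:
  "x * poly (pderiv (shifted_laguerre (Suc k))) x =
     real k * poly (shifted_laguerre (Suc k)) x - real (Suc k) * poly (shifted_laguerre k) x
   \<and> x * poly (pderiv (shifted_laguerre k)) x =
     real k * poly (shifted_laguerre (Suc k)) x - (real (Suc k) - x) * poly (shifted_laguerre k) x"
proof (induction k)
  case (Suc k)
  define l0 l1 l2 where "l0 = poly (shifted_laguerre k) x"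
    and "l1 = poly (shifted_laguerre (Suc k)) x"
    and "l2 = poly (shifted_laguerre (Suc (Suc k))) x"
  define d0 d1 d2 where "d0 = poly (pderiv (shifted_laguerre k)) x"
    and "d1 = poly (pderiv (shifted_laguerre (Suc k))) x"
    and "d2 = poly (pderiv (shifted_laguerre (Suc (Suc k)))) x"
  define K where "K = real k"
  have K: "K + 1 \<noteq> 0"
    by (simp add: K_def)
  have l2: "(K + 1) * l2 = (2 * (K + 1) - x) * l1 - (K + 1) * l0"
    using poly_shifted_laguerre_Suc_Suc[of k x]
    unfolding l0_def l1_def l2_def K_def by (simp add: add_ac)
  have d2: "(K + 1) * d2 = (2 * (K + 1) - x) * d1 - l1 - (K + 1) * d0"
  proof -
    define c where "c = 1 / (K + 1)"
    have "d2 = 2 * d1 - c * (l1 + x * d1) - d0"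
      unfolding d0_def d1_def d2_def l1_def c_def K_def shifted_laguerre.simps(3)
        pderiv_diff pderiv_mult
      by (simp add: pderiv_pCons algebra_simps)
    then have "(K + 1) * d2 = 2 * (K + 1) * d1 - ((K + 1) * c) * (l1 + x * d1) - (K + 1) * d0"
      by (simp only: right_diff_distrib mult_ac)
    also have "(K + 1) * c = 1"
      using K by (simp add: c_def)
    finally show ?thesis
      by (simp add: algebra_simps)
  qed
  have d1: "x * d1 = K * l1 - (K + 1) * l0" and d0: "x * d0 = K * l1 - (K + 1 - x) * l0"
    using Suc.IH unfolding l0_def l1_def d0_def d1_def K_def by (simp_all add: add_ac)
  have "(K + 1) * (x * d2) = x * ((K + 1) * d2)"
    by simp
  also have "\<dots> = (2 * (K + 1) - x) * (x * d1) - x * l1 - (K + 1) * (x * d0)"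
    unfolding d2 by (simp add: algebra_simps)
  also have "\<dots> = (K + 1) * ((2 * (K + 1) - x) * l1 - (K + 1) * l0 - (K + 2) * l1)"
    unfolding d1 d0 by (simp add: algebra_simps)
  also have "\<dots> = (K + 1) * ((K + 1) * l2 - (K + 2) * l1)"
    unfolding l2 ..
  finally have "x * d2 = (K + 1) * l2 - (K + 2) * l1"
    using K by simp
  moreover have "x * d1 = (K + 1) * l2 - (K + 2 - x) * l1"
    unfolding l2 d1 by (simp add: algebra_simps)
  ultimately show ?case
    unfolding l0_def l1_def l2_def d0_def d1_def d2_def K_def by (simp add: add_ac)
qed auto

lemma poly_ext: "(\<And>x::real. poly p x = poly q x) \<Longrightarrow> p = q"
  by (simp add: poly_eq_poly_eq_iff[symmetric] fun_eq_iff)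

lemma X_pderiv_shifted_laguerre_Suc:
  "[:0, 1:] * pderiv (shifted_laguerre (Suc k)) =
     Polynomial.smult (real k) (shifted_laguerre (Suc k))
     - Polynomial.smult (real (Suc k)) (shifted_laguerre k)"
  using poly_pderiv_shifted_laguerre[of _ k] by (intro poly_ext) simp

lemma X_pderiv_shifted_laguerre:
  "[:0, 1:] * pderiv (shifted_laguerre k) =
     Polynomial.smult (real k) (shifted_laguerre (Suc k))
     - Polynomial.smult (real (Suc k)) (shifted_laguerre k) + [:0, 1:] * shifted_laguerre k"
  using poly_pderiv_shifted_laguerre[of _ k] by (intro poly_ext) (simp add: algebra_simps)

lemma X_shifted_laguerre_Suc:
  "[:0, 1:] * shifted_laguerre (Suc k) =
     Polynomial.smult (2 * real (Suc k)) (shifted_laguerre (Suc k))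
     - Polynomial.smult (real (Suc k)) (shifted_laguerre (Suc (Suc k)))
     - Polynomial.smult (real (Suc k)) (shifted_laguerre k)"
proof (rule poly_ext)
  fix x
  show "poly ([:0, 1:] * shifted_laguerre (Suc k)) x = poly
     (Polynomial.smult (2 * real (Suc k)) (shifted_laguerre (Suc k))
     - Polynomial.smult (real (Suc k)) (shifted_laguerre (Suc (Suc k)))
     - Polynomial.smult (real (Suc k)) (shifted_laguerre k)) x"
    using poly_shifted_laguerre_Suc_Suc[of k x]
    unfolding poly_mult poly_diff poly_smult by (simp add: algebra_simps)
qed

section \<open>Integrals of x^n against products of two Laguerre polynomials\<close>

definition laguerre_moment :: "nat \<Rightarrow> nat \<Rightarrow> nat \<Rightarrow> real" where
  "laguerre_moment n i j =
     laguerre_functional ([:0, 1:] ^ n * (shifted_laguerre i * shifted_laguerre j))"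

lemma laguerre_moment_commute: "laguerre_moment n i j = laguerre_moment n j i"
  by (simp add: laguerre_moment_def mult.commute)

text \<open>Integration by parts applied to x^n f g. Each derivative keeps a factor x of its own
  because the derivative formulas express x l_k' and not l_k'.\<close>

lemma laguerre_functional_by_parts:
  fixes n :: nat
  shows "real n * laguerre_functional ([:0, 1:] ^ n * (f * g))
    + laguerre_functional ([:0, 1:] ^ n * (([:0, 1:] * pderiv f) * g))
    + laguerre_functional ([:0, 1:] ^ n * (f * ([:0, 1:] * pderiv g)))
    = laguerre_functional ([:0, 1:] ^ Suc n * (f * g))
      - 2 * laguerre_functional ([:0, 1:] ^ n * (f * g))"
proof -
  define X :: "real poly" where "X = [:0, 1:]"
  have deriv: "X * pderiv (X ^ n * (f * g)) = Polynomial.smult (real n) (X ^ n * (f * g))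
      + X ^ n * ((X * pderiv f) * g) + X ^ n * (f * (X * pderiv g))"
  proof -
    have "X * pderiv (X ^ n) = Polynomial.smult (real n) (X ^ n)"
    proof (induction n)
      case (Suc n)
      have "pderiv X = 1"
        by (simp add: X_def pderiv_pCons)
      then have "X * pderiv (X ^ Suc n) = X ^ Suc n + X * (X * pderiv (X ^ n))"
        by (simp add: pderiv_mult algebra_simps)
      then show ?case
        by (simp add: Suc Polynomial.smult_add_left)
    qed simp
    then have "X * pderiv (X ^ n) * (f * g) = Polynomial.smult (real n) (X ^ n * (f * g))"
      by simp
    then show ?thesis
      unfolding pderiv_mult by (simp add: algebra_simps)
  qed
  have "laguerre_functional (X * pderiv (X ^ n * (f * g))) =
      laguerre_functional (X * (X ^ n * (f * g))) - 2 * laguerre_functional (X ^ n * (f * g))"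
    unfolding X_def by (rule laguerre_functional_pderiv)
  then show ?thesis
    unfolding deriv laguerre_functional_linear X_def[symmetric] power_Suc mult.assoc .
qed

lemma laguerre_moment_Suc_PP:
  "laguerre_moment (Suc n) (Suc N) (Suc N) =
     (real n + 2 + 2 * real N) * laguerre_moment n (Suc N) (Suc N)
     - 2 * (real N + 1) * laguerre_moment n (Suc N) N"
  using laguerre_functional_by_parts[of n "shifted_laguerre (Suc N)" "shifted_laguerre (Suc N)"]
  unfolding X_pderiv_shifted_laguerre_Suc left_diff_distrib right_diff_distrib
    mult_smult_left mult_smult_right laguerre_functional_linear laguerre_moment_def[symmetric]
    laguerre_moment_commute[of n N "Suc N"]
  by (simp add: algebra_simps)

text \<open>Raising is used in both factors. It creates two terms with x^(n+1) against the single
  one from integration by parts, so the relation can still be solved for the next moment.\<close>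

lemma laguerre_moment_Suc_QQ:
  "laguerre_moment (Suc n) N N =
     (2 * real N - real n) * laguerre_moment n N N - 2 * real N * laguerre_moment n (Suc N) N"
proof -
  have X: "[:0, 1:] * ([:0, 1:] ^ n * p) = [:0, 1:] ^ Suc n * p" for p :: "real poly"
    by (simp only: power_Suc mult_ac)
  show ?thesis
    using laguerre_functional_by_parts[of n "shifted_laguerre N" "shifted_laguerre N"]
    unfolding X_pderiv_shifted_laguerre left_diff_distrib right_diff_distrib
      distrib_left distrib_right mult.left_commute[of _ "[:0, 1:]"] mult.assoc X
      mult_smult_left mult_smult_right laguerre_functional_linear laguerre_moment_def[symmetric]
      laguerre_moment_commute[of n N "Suc N"]
    by (simp add: algebra_simps)
qed

text \<open>Lowering one factor and raising the other creates exactly one term with x^(n+1), and it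
  cancels the one from integration by parts. What remains is a linear relation at fixed n.\<close>

lemma laguerre_moment_mixed:
  "(real n + real i + 1 - real j) * laguerre_moment n (Suc i) j =
     real (Suc i) * laguerre_moment n i j - real j * laguerre_moment n (Suc i) (Suc j)"
proof -
  have X: "[:0, 1:] * ([:0, 1:] ^ n * p) = [:0, 1:] ^ Suc n * p" for p :: "real poly"
    by (simp only: power_Suc mult_ac)
  show ?thesis
    using laguerre_functional_by_parts[of n "shifted_laguerre (Suc i)" "shifted_laguerre j"]
    unfolding X_pderiv_shifted_laguerre_Suc[of i] X_pderiv_shifted_laguerre[of j]
      left_diff_distrib right_diff_distrib
      distrib_left distrib_right mult.left_commute[of _ "[:0, 1:]"] mult.assoc X
      mult_smult_left mult_smult_right laguerre_functional_linear laguerre_moment_def[symmetric]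
    by (simp add: algebra_simps)
qed

lemma laguerre_moment_Suc_three_term:
  "laguerre_moment (Suc n) i (Suc k) = real (Suc k) * (2 * laguerre_moment n i (Suc k)
     - laguerre_moment n i (Suc (Suc k)) - laguerre_moment n i k)"
proof -
  have X: "[:0, 1:] ^ Suc n * (shifted_laguerre i * shifted_laguerre (Suc k)) =
      [:0, 1:] ^ n * (shifted_laguerre i * ([:0, 1:] * shifted_laguerre (Suc k)))"
    by (simp only: power_Suc mult_ac)
  show ?thesis
    unfolding laguerre_moment_def X
    unfolding X_shifted_laguerre_Suc right_diff_distrib mult_smult_right
      laguerre_functional_linear
    by (simp add: algebra_simps)
qed

section \<open>Orthogonality\<close>

abbreviation laguerre_form :: "nat \<Rightarrow> nat \<Rightarrow> real" where
  "laguerre_form \<equiv> laguerre_moment 0"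

lemma laguerre_moment_0_left [simp]: "laguerre_moment n 0 j = 0"
  by (simp add: laguerre_moment_def)

text \<open>For j = i + 1 the left coefficient of \<open>laguerre_moment_mixed\<close> vanishes,
  which settles the first entry to the right of the diagonal; from there the same relation moves
  along the row.\<close>

lemma laguerre_form_less: "i < j \<Longrightarrow> laguerre_form i j = 0"
proof (induction i arbitrary: j)
  case (Suc i)
  note IH = Suc.IH
  have "laguerre_form (Suc i) (Suc (Suc (i + m))) = 0" for m
  proof (induction m)
    case 0
    show ?case
      using laguerre_moment_mixed[of 0 i "Suc i"] IH[of "Suc i"] by simp
  next
    case (Suc m)
    then show ?case
      using laguerre_moment_mixed[of 0 i "Suc (Suc (i + m))"] IH[of "Suc (Suc (i + m))"]
      by simp
  qed
  moreover obtain m where "j = Suc (Suc (i + m))"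
    using Suc.prems less_imp_Suc_add[of "Suc i" j] by auto
  ultimately show ?case
    by simp
qed simp

text \<open>On the diagonal, orthogonality kills the left side of
  \<open>laguerre_moment_mixed\<close> and leaves the ratio of consecutive squared norms.\<close>

lemma laguerre_form_eq: "laguerre_form i j = (if i = j then real i else 0)"
proof -
  have diag: "laguerre_form (Suc i) (Suc i) = real (Suc i)" for i
  proof (induction i)
    case (Suc i)
    have "laguerre_form (Suc (Suc i)) (Suc i) = 0"
      using laguerre_form_less[of "Suc i" "Suc (Suc i)"]
      by (simp add: laguerre_moment_commute[of _ _ "Suc i"])
    then have "(real i + 1) * laguerre_form (Suc (Suc i)) (Suc (Suc i)) =
        (real i + 1) * real (Suc (Suc i))"
      using laguerre_moment_mixed[of 0 "Suc i" "Suc i"] Suc by (simp add: algebra_simps)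
    then show ?case
      by (subst (asm) mult_cancel_left) auto
  qed (simp add: laguerre_moment_def)
  show ?thesis
  proof (cases i j rule: linorder_cases)
    case equal
    then show ?thesis
      using diag[of "i - 1"] by (cases i) auto
  next
    case greater
    then show ?thesis
      using laguerre_form_less[of j i] by (simp add: laguerre_moment_commute[of _ i])
  qed (simp add: laguerre_form_less)
qed

section \<open>Moments of the trace and their recurrence\<close>

text \<open>The mean of the n-th power sum of the eigenvalues of N H: their one-point density is the
  weight times the sum of the squared normalized polynomials, and \<open>real (Suc k)\<close> is the
  squared norm.\<close>

definition laguerre_trace_moment :: "nat \<Rightarrow> nat \<Rightarrow> real" where
  "laguerre_trace_moment N n = (\<Sum>k<N. laguerre_moment n (Suc k) (Suc k) / real (Suc k))"

text \<open>The integral of x^(n+1) l_(N+1)^2 is known twice, by parts and from the three-term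
  recurrence. Comparing both turns n times each summand into a difference of neighbouring mixed
  integrals, and the sum telescopes. At n = 0 this does not determine the moment, which is computed
  separately.\<close>

lemma laguerre_trace_moment_eq:
  "real n * laguerre_trace_moment N n = - laguerre_moment n (Suc N) N"
proof (induction N)
  case 0
  show ?case
    by (simp add: laguerre_trace_moment_def laguerre_moment_commute[of _ "Suc 0"])
next
  case (Suc N)
  define P B C where "P = laguerre_moment n (Suc N) (Suc N)"
    and "B = laguerre_moment n (Suc N) N" and "C = laguerre_moment n (Suc (Suc N)) (Suc N)"
  have "real n * P = (real N + 1) * (B - C)"
    using laguerre_moment_Suc_PP[of n N] laguerre_moment_Suc_three_term[of n "Suc N" N]
    unfolding P_def B_def C_def laguerre_moment_commute[of n "Suc (Suc N)"]
    by (simp add: algebra_simps)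
  then have "real n * (P / real (Suc N)) = B - C"
    by (simp add: field_simps)
  with Suc show ?case
    unfolding P_def B_def C_def by (simp add: laguerre_trace_moment_def algebra_simps)
qed

lemma laguerre_trace_moment_0: "laguerre_trace_moment N 0 = real N"
  by (simp add: laguerre_trace_moment_def laguerre_form_eq del: of_nat_Suc)

lemma laguerre_trace_moment_1: "laguerre_trace_moment N (Suc 0) = real N * (real N + 1)"
proof -
  have "2 * laguerre_moment (Suc 0) (Suc N) N = - 2 * real N * (real N + 1)"
    using laguerre_moment_mixed[of "Suc 0" N N]
    by (simp add: laguerre_moment_Suc_PP laguerre_moment_Suc_QQ laguerre_form_eq algebra_simps)
  then show ?thesis
    using laguerre_trace_moment_eq[of "Suc 0" N] by simp
qed

text \<open>The Haagerup--Thorbjoernsen recurrence, for the parameter \<open>\<alpha> = 1\<close>.\<close>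

lemma laguerre_trace_moment_rec:
  "(real n + 3) * laguerre_trace_moment N (Suc (Suc n)) =
     (2 * real N + 1) * (2 * real n + 3) * laguerre_trace_moment N (Suc n)
     + (real n)\<^sup>2 * (real n + 2) * laguerre_trace_moment N n"
proof -
  define r s where "r = real n" and "s = real N"
  define P where "P k = laguerre_moment k (Suc N) (Suc N)" for k
  define B where "B k = laguerre_moment k (Suc N) N" for k
  define Q where "Q k = laguerre_moment k N N" for k
  have P: "P (Suc k) = (real k + 2 + 2 * s) * P k - 2 * (s + 1) * B k" for k
    unfolding P_def B_def s_def by (rule laguerre_moment_Suc_PP)
  have Q: "Q (Suc k) = (2 * s - real k) * Q k - 2 * s * B k" for k
    unfolding Q_def B_def s_def by (rule laguerre_moment_Suc_QQ)
  have B: "(real k + 1) * B k = (s + 1) * Q k - s * P k" for k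
    using laguerre_moment_mixed[of k N N]
    unfolding Q_def P_def B_def s_def by (simp add: add_ac)
  \<comment> \<open>\<open>B k\<close> is, up to the factor k + 1, the difference of (s + 1) Q and s
    P; \<open>S k\<close> is their sum. In these two coordinates the system is first order of size
    two.\<close>
  define S where "S k = (s + 1) * Q k + s * P k" for k
  have B_Suc: "(real k + 2) * B (Suc k) = (2 * s + 1) * ((real k + 1) * B k) - (real k + 1) * S k" for k
    using B[of "Suc k"] unfolding B[of k] S_def P Q by (simp add: algebra_simps)
  have S_Suc: "S (Suc k) = (2 * s + 1) * S k - (real k + 1) * ((real k + 1) * B k) - 4 * s * (s + 1) * B k"
    for k
    unfolding B[of k] unfolding S_def P Q by (simp add: algebra_simps)
  have "(r + 3) * (r + 1) * B (Suc (Suc n)) =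
      (r + 1) * ((2 * s + 1) * ((r + 2) * B (Suc n)) - (r + 2) * S (Suc n))"
    using B_Suc[of "Suc n"] by (simp add: r_def add_ac)
  also have "\<dots> = (r + 2) * ((2 * s + 1) * (r + 1) * B (Suc n) - (2 * s + 1) * ((r + 1) * S n)
      + (r + 1) ^ 3 * B n + 4 * s * (s + 1) * (r + 1) * B n)"
    unfolding S_Suc r_def[symmetric] by (simp add: algebra_simps power3_eq_cube)
  also have "(r + 1) * S n = (2 * s + 1) * ((r + 1) * B n) - (r + 2) * B (Suc n)"
    using B_Suc[of n] by (simp add: r_def)
  \<comment> \<open>Here (r + 1)^2 + 4 s (s + 1) - (2 s + 1)^2 = r (r + 2) removes \<open>s\<close>
    from the coefficient of \<open>B n\<close>.\<close>
  finally have "(r + 3) * (r + 1) * B (Suc (Suc n)) =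
      (2 * s + 1) * (r + 2) * (2 * r + 3) * B (Suc n) + (r + 1) * r * (r + 2)\<^sup>2 * B n"
    by (simp add: algebra_simps power3_eq_cube power2_eq_square)
  moreover have "B n = - r * laguerre_trace_moment N n"
    "B (Suc n) = - (r + 1) * laguerre_trace_moment N (Suc n)"
    "B (Suc (Suc n)) = - (r + 2) * laguerre_trace_moment N (Suc (Suc n))"
    using laguerre_trace_moment_eq[of n N] laguerre_trace_moment_eq[of "Suc n" N]
      laguerre_trace_moment_eq[of "Suc (Suc n)" N]
    unfolding B_def r_def by (simp_all add: algebra_simps)
  ultimately have "((r + 1) * (r + 2)) * ((r + 3) * laguerre_trace_moment N (Suc (Suc n))) =
     ((r + 1) * (r + 2)) * ((2 * s + 1) * (2 * r + 3) * laguerre_trace_moment N (Suc n)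
     + r\<^sup>2 * (r + 2) * laguerre_trace_moment N n)"
    by (simp add: algebra_simps power2_eq_square)
  moreover have "(r + 1) * (r + 2) \<noteq> 0"
    by (simp add: r_def)
  ultimately show ?thesis
    unfolding r_def s_def mult_cancel_left by blast
qed

subsection \<open>Traces of powers\<close>

lemma mat_trace_mult_commute:
  assumes "A \<in> carrier_mat n n" "B \<in> carrier_mat n n"
  shows "mat_trace (A * B) = mat_trace (B * A)"
proof -
  have "mat_trace (A * B) = (\<Sum>i<n. \<Sum>j<n. A $$ (i, j) * B $$ (j, i))"
    using assms by (auto simp: mat_trace_def scalar_prod_def atLeast0LessThan intro!: sum.cong)
  also have "\<dots> = (\<Sum>j<n. \<Sum>i<n. B $$ (j, i) * A $$ (i, j))"
    by (subst sum.swap) (simp add: mult.commute)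
  also have "\<dots> = mat_trace (B * A)"
    using assms by (auto simp: mat_trace_def scalar_prod_def atLeast0LessThan intro!: sum.cong)
  finally show ?thesis .
qed

text \<open>In the product, the term with inner index l vanishes unless i <= l <= j: none is left
  below the diagonal, and only l = i on it.\<close>

lemma upper_triangular_pow:
  fixes B :: "'a::comm_semiring_1 mat"
  assumes B: "B \<in> carrier_mat n n" and ut: "upper_triangular B"
  shows "upper_triangular (B ^\<^sub>m k) \<and> (\<forall>i<n. (B ^\<^sub>m k) $$ (i, i) = (B $$ (i, i)) ^ k)"
proof (induction k)
  case 0
  show ?case
    using B by auto
next
  case (Suc k)
  have Bk: "B ^\<^sub>m k \<in> carrier_mat n n"
    using B by simp
  have zero: "(B ^\<^sub>m k) $$ (i, l) * B $$ (l, j) = 0" if "i < n" "l < n" "l < i \<or> j < l" for i j l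
    using that upper_triangularD[of "B ^\<^sub>m k" l i] upper_triangularD[OF ut, of j l] Suc B Bk
    by auto
  have entry: "(B ^\<^sub>m Suc k) $$ (i, j) = (\<Sum>l<n. (B ^\<^sub>m k) $$ (i, l) * B $$ (l, j))"
    if "i < n" "j < n" for i j
    using that B Bk by (simp add: scalar_prod_def atLeast0LessThan)
  have "(B ^\<^sub>m Suc k) $$ (i, j) = 0" if "i < n" "j < i" for i j
  proof -
    have "i < n" "j < n"
      using that by auto
    moreover have "(B ^\<^sub>m k) $$ (i, l) * B $$ (l, j) = 0" if "l < n" for l
      using zero[of i l j] \<open>i < n\<close> \<open>j < n\<close> \<open>j < i\<close> that by (cases "l < i") auto
    ultimately show ?thesis
      unfolding entry[OF \<open>i < n\<close> \<open>j < n\<close>] by (intro sum.neutral) auto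
  qed
  moreover have "(B ^\<^sub>m Suc k) $$ (i, i) = (B $$ (i, i)) ^ Suc k" if i: "i < n" for i
  proof -
    have "(B ^\<^sub>m Suc k) $$ (i, i) = (\<Sum>l\<in>{i}. (B ^\<^sub>m k) $$ (i, l) * B $$ (l, i))"
      unfolding entry[OF i i] using i zero[of i _ i]
      by (intro sum.mono_neutral_right) (auto simp: neq_iff)
    then show ?thesis
      using Suc i by (simp add: mult.commute)
  qed
  ultimately show ?case
    using B by (intro conjI upper_triangularI allI impI) simp_all
qed

text \<open>A Schur decomposition makes \<open>A\<close> similar to a triangular matrix with the
  prescribed roots on the diagonal. Powers keep that shape, and cyclicity of the trace removes the
  conjugation.\<close>

lemma mat_trace_pow:
  assumes A: "A \<in> carrier_mat n n" and cp: "char_poly A = (\<Prod>i<n. [:- a i, 1:])"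
  shows "mat_trace (A ^\<^sub>m k) = (\<Sum>i<n. a i ^ k)"
proof -
  have "char_poly A = (\<Prod>e\<leftarrow>map a [0..<n]. [:- e, 1:])"
    unfolding cp by (simp add: prod.distinct_set_conv_list[symmetric] comp_def atLeast0LessThan)
  moreover obtain B P Q where "schur_decomposition A (map a [0..<n]) = (B, P, Q)"
    by (metis prod_cases3)
  ultimately have wit: "similar_mat_wit A B P Q" and ut: "upper_triangular B"
    and diag: "diag_mat B = map a [0..<n]"
    using schur_decomposition[OF A] by blast+
  note wit' = similar_mat_witD2[OF A wit]
  have B: "B \<in> carrier_mat n n" and P: "P \<in> carrier_mat n n" and Q: "Q \<in> carrier_mat n n"
    using wit' by auto
  have Bk: "B ^\<^sub>m k \<in> carrier_mat n n"
    using B by simp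
  have "mat_trace (A ^\<^sub>m k) = mat_trace (P * (B ^\<^sub>m k * Q))"
    using similar_mat_wit_pow_id[OF wit, of k] P Bk Q by simp
  also have "\<dots> = mat_trace ((B ^\<^sub>m k * Q) * P)"
    using P Bk Q by (intro mat_trace_mult_commute[of _ n]) auto
  also have "(B ^\<^sub>m k * Q) * P = B ^\<^sub>m k"
    using P Bk Q wit' by (simp add: assoc_mult_mat[OF Bk Q P])
  also have "mat_trace (B ^\<^sub>m k) = (\<Sum>i<n. a i ^ k)"
  proof -
    have "B $$ (i, i) = a i" if "i < n" for i
      using arg_cong[OF diag, of "\<lambda>xs. xs ! i"] that B by (simp add: diag_mat_def)
    then show ?thesis
      using upper_triangular_pow[OF B ut, of k] B by (simp add: mat_trace_def)
  qed
  finally show ?thesis .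
qed

subsection \<open>Vandermonde determinants\<close>

text \<open>The matrix is the Vandermonde matrix times the coefficient matrix, which is upper
  triangular by the degree bound.\<close>

lemma det_poly_mat:
  fixes p :: "nat \<Rightarrow> 'a::comm_ring_1 poly"
  assumes deg: "\<And>i. i < n \<Longrightarrow> degree (p i) \<le> i"
  shows "Determinant.det (mat n n (\<lambda>(j, i). poly (p i) (x j))) =
     (\<Prod>i<n. coeff (p i) i) * Determinant.det (mat n n (\<lambda>(j, i). x j ^ i))"
proof -
  define V where "V = mat n n (\<lambda>(j, i). x j ^ i)"
  define T where "T = mat n n (\<lambda>(m, i). coeff (p i) m)"
  have VT: "V \<in> carrier_mat n n" "T \<in> carrier_mat n n"
    by (auto simp: V_def T_def)
  have "mat n n (\<lambda>(j, i). poly (p i) (x j)) = V * T"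
  proof (rule eq_matI)
    fix j i assume "j < dim_row (V * T)" "i < dim_col (V * T)"
    then have ji: "j < n" "i < n"
      by (auto simp: V_def T_def)
    have "poly (p i) (x j) = (\<Sum>m<n. coeff (p i) m * x j ^ m)"
      unfolding poly_altdef using deg[of i] ji
      by (intro sum.mono_neutral_left) (auto simp: coeff_eq_0)
    then show "mat n n (\<lambda>(j, i). poly (p i) (x j)) $$ (j, i) = (V * T) $$ (j, i)"
      using ji by (simp add: V_def T_def scalar_prod_def atLeast0LessThan mult.commute)
  qed (auto simp: V_def T_def)
  moreover have "Determinant.det T = (\<Prod>i<n. coeff (p i) i)"
  proof -
    have "upper_triangular T"
    proof (rule upper_triangularI)
      fix m i assume "i < m" "m < dim_row T"
      then show "T $$ (m, i) = 0"
        using deg[of i] by (simp add: T_def coeff_eq_0)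
    qed
    then show ?thesis
      using det_upper_triangular[OF _ VT(2)]
      by (simp add: prod_list_diag_prod T_def atLeast0LessThan)
  qed
  ultimately show ?thesis
    using det_mult[OF VT] by (simp add: V_def mult.commute)
qed

text \<open>
  Applied to the Newton basis \<open>(X - x\<^sub>0) \<cdots> (X - x\<^sub>i\<^sub>-\<^sub>1)\<close>, the preceding lemma
  produces a triangular matrix.
\<close>

lemma det_vandermonde:
  fixes x :: "nat \<Rightarrow> 'a::idom"
  shows "Determinant.det (mat n n (\<lambda>(j, i). x j ^ i)) = (\<Prod>j<n. \<Prod>i<j. x j - x i)"
proof -
  define p where "p i = (\<Prod>k<i. [:- x k, 1:])" for i
  have p: "degree (p i) = i" "coeff (p i) i = 1" for i
  proof -
    show d: "degree (p i) = i"
      unfolding p_def by (subst degree_prod_eq_sum_degree) auto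
    have "lead_coeff (p i) = 1"
      unfolding p_def by (simp add: lead_coeff_prod)
    then show "coeff (p i) i = 1"
      by (simp add: d)
  qed
  have eval: "poly (p i) y = (\<Prod>k<i. y - x k)" for i y
    by (simp add: p_def poly_prod)
  have "Determinant.det (mat n n (\<lambda>(j, i). x j ^ i)) =
      Determinant.det (mat n n (\<lambda>(j, i). poly (p i) (x j)))"
    by (subst det_poly_mat) (simp_all add: p)
  also have "\<dots> = prod_list (diag_mat (mat n n (\<lambda>(j, i). poly (p i) (x j))))"
    by (rule det_lower_triangular[where n = n]) (auto simp: eval)
  also have "\<dots> = (\<Prod>j<n. \<Prod>i<j. x j - x i)"
    by (simp add: prod_list_diag_prod eval atLeast0LessThan)
  finally show ?thesis .
qed

subsection \<open>Integrating the squared determinant\<close>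

text \<open>The values away from \<open>k\<close> exhaust the set up to one element. In the integral
  below the variable \<open>k\<close> carries the extra factor \<open>g\<close>, so orthogonality
  applies only at the others; two distinct permutations always differ at one of these.\<close>

lemma permutes_eqI_except:
  assumes p: "p permutes S" and q: "q permutes S" and eq: "\<And>j. j \<in> S \<Longrightarrow> j \<noteq> k \<Longrightarrow> p j = q j"
  shows "p = q"
proof (rule ext)
  fix j
  show "p j = q j"
  proof (cases "j \<in> S \<and> j = k")
    case False
    then show ?thesis
      using eq p q by (cases "j \<in> S") (auto simp: permutes_not_in)
  next
    case True
    then have k: "k \<in> S" "j = k"
      by auto
    have "p ` (S - {k}) = q ` (S - {k})"
      using eq by (intro image_cong) auto
    then have "S - {p k} = S - {q k}"
      using permutes_inj[OF p] permutes_inj[OF q] permutes_image[OF p] permutes_image[OF q]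
      by (simp add: image_set_diff)
    moreover have "p k \<in> S" "q k \<in> S"
      using k p q by (auto simp: permutes_in_image)
    ultimately show ?thesis
      using k by blast
  qed
qed

text \<open>
  Andreief's identity with one marked variable: in the expansion of the squared determinant only
  pairs of equal permutations survive the integration.
\<close>

lemma integral_det_square:
  fixes \<phi> :: "nat \<Rightarrow> real \<Rightarrow> real" and g \<rho> :: "real \<Rightarrow> real"
  assumes int1: "\<And>a b. a < N \<Longrightarrow> b < N \<Longrightarrow> integrable lborel (\<lambda>x. \<phi> a x * \<phi> b x * \<rho> x)"
    and intg: "\<And>a b. a < N \<Longrightarrow> b < N \<Longrightarrow> integrable lborel (\<lambda>x. \<phi> a x * \<phi> b x * \<rho> x * g x)"
    and orth: "\<And>a b. a < N \<Longrightarrow> b < N \<Longrightarrow>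
      (LINT x|lborel. \<phi> a x * \<phi> b x * \<rho> x) = (if a = b then h a else 0)"
    and h: "\<And>a. a < N \<Longrightarrow> h a \<noteq> 0"
  shows "(LINT x|Pi\<^sub>M {..<N} (\<lambda>_. lborel).
      (Determinant.det (mat N N (\<lambda>(j, i). \<phi> i (x j))))\<^sup>2 * (\<Prod>j<N. \<rho> (x j)) * (\<Sum>k<N. g (x k))) =
    fact N * (\<Prod>i<N. h i) * (\<Sum>i<N. (LINT x|lborel. \<phi> i x * \<phi> i x * \<rho> x * g x) / h i)"
proof -
  interpret product_sigma_finite "\<lambda>_::nat. lborel :: real measure"
    by standard
  let ?S = "{p. p permutes {..<N}}"
  have fin: "finite ?S"
    by (simp add: finite_permutations)
  define F where "F k p q j x =
    \<phi> (p j) x * \<phi> (q j) x * \<rho> x * (if j = k then g x else 1)" for k j x and p q :: "nat \<Rightarrow> nat"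
  define I where "I a = (LINT x|lborel. \<phi> a x * \<phi> a x * \<rho> x * g x)" for a
  have in_range: "p j < N" if "p permutes {..<N}" "j < N" for p j
    using permutes_in_image[OF that(1), of j] that(2) by simp
  have F_int: "integrable lborel (F k p q j)" if "p \<in> ?S" "q \<in> ?S" "j < N" for k p q j
    using int1[of "p j" "q j"] intg[of "p j" "q j"] in_range that
    by (cases "j = k") (simp_all add: F_def[abs_def])
  have expand: "(Determinant.det (mat N N (\<lambda>(j, i). \<phi> i (x j))))\<^sup>2 * (\<Prod>j<N. \<rho> (x j)) * (\<Sum>k<N. g (x k))
      = (\<Sum>p\<in>?S. \<Sum>q\<in>?S. \<Sum>k<N. signof p * signof q * (\<Prod>j<N. F k p q j (x j)))" for x
  proof -
    have "Determinant.det (mat N N (\<lambda>(j, i). \<phi> i (x j))) =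
        (\<Sum>p\<in>?S. signof p * (\<Prod>j<N. \<phi> (p j) (x j)))"
      by (subst det_def'[of _ N])
         (auto simp: atLeast0LessThan in_range intro!: sum.cong prod.cong)
    moreover have "(\<Prod>j<N. F k p q j (x j)) = (\<Prod>j<N. \<phi> (p j) (x j)) * (\<Prod>j<N. \<phi> (q j) (x j))
        * (\<Prod>j<N. \<rho> (x j)) * g (x k)" if "k < N" for k p q
      using that by (simp add: F_def prod.distrib)
    ultimately show ?thesis
      by (simp add: power2_eq_square sum_product sum_distrib_left sum_distrib_right mult_ac)
  qed
  have term_eq: "(\<Prod>j<N. LINT x|lborel. F k p q j x) =
      (if p = q then (\<Prod>i<N. h i) * (I (p k) / h (p k)) else 0)"
    if pq: "p \<in> ?S" "q \<in> ?S" and k: "k < N" for k p q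
  proof (cases "p = q")
    case True
    have "(\<Prod>j<N. LINT x|lborel. F k p q j x) = I (p k) * (\<Prod>j\<in>{..<N} - {k}. h (p j))"
    proof (subst prod.remove[of _ k])
      show "(LINT x|lborel. F k p q k x) * (\<Prod>j\<in>{..<N} - {k}. LINT x|lborel. F k p q j x) =
          I (p k) * (\<Prod>j\<in>{..<N} - {k}. h (p j))"
        using orth in_range pq
        by (intro arg_cong2[where f = "(*)"] prod.cong) (auto simp: F_def I_def True)
    qed (use k in auto)
    also have "\<dots> = (\<Prod>j<N. h (p j)) * (I (p k) / h (p k))"
      using h[of "p k"] in_range pq k by (simp add: prod.remove[of "{..<N}" k])
    also have "(\<Prod>j<N. h (p j)) = (\<Prod>i<N. h i)"
      using pq by (intro prod.reindex_bij_betw) (auto simp: permutes_imp_bij)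
    finally show ?thesis
      using True by simp
  next
    case False
    then obtain j where j: "j < N" "j \<noteq> k" "p j \<noteq> q j"
      using permutes_eqI_except[of p "{..<N}" q k] pq by auto
    then have "(LINT x|lborel. F k p q j x) = 0"
      using orth[of "p j" "q j"] in_range pq by (simp add: F_def)
    then show ?thesis
      using False j by auto
  qed
  have "(LINT x|Pi\<^sub>M {..<N} (\<lambda>_. lborel).
      (Determinant.det (mat N N (\<lambda>(j, i). \<phi> i (x j))))\<^sup>2 * (\<Prod>j<N. \<rho> (x j)) * (\<Sum>k<N. g (x k))) =
      (\<Sum>p\<in>?S. \<Sum>q\<in>?S. \<Sum>k<N. LINT x|Pi\<^sub>M {..<N} (\<lambda>_. lborel).
        signof p * signof q * (\<Prod>j<N. F k p q j (x j)))"
  proof -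
    have T: "integrable (Pi\<^sub>M {..<N} (\<lambda>_. lborel))
        (\<lambda>x. signof p * signof q * (\<Prod>j<N. F k p q j (x j)))" if "p \<in> ?S" "q \<in> ?S" for k p q
      using F_int[OF that] by (intro integrable_mult_right product_integrable_prod) auto
    show ?thesis
      unfolding expand
      by (subst Bochner_Integration.integral_sum, intro Bochner_Integration.integrable_sum T,
          assumption+, rule sum.cong[OF refl])+ (rule refl)
  qed
  also have "\<dots> = (\<Sum>p\<in>?S. \<Sum>q\<in>?S. \<Sum>k<N.
      signof p * signof q * (if p = q then (\<Prod>i<N. h i) * (I (p k) / h (p k)) else 0))"
  proof (intro sum.cong refl)
    fix p q k assume pq: "p \<in> ?S" "q \<in> ?S" and k: "k \<in> {..<N}"
    have "(LINT x|Pi\<^sub>M {..<N} (\<lambda>_. lborel). (\<Prod>j<N. F k p q j (x j))) =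
        (if p = q then (\<Prod>i<N. h i) * (I (p k) / h (p k)) else 0)"
      using F_int[OF pq] term_eq[OF pq, of k] k by (subst product_integral_prod) auto
    then show "(LINT x|Pi\<^sub>M {..<N} (\<lambda>_. lborel).
        signof p * signof q * (\<Prod>j<N. F k p q j (x j))) =
      signof p * signof q * (if p = q then (\<Prod>i<N. h i) * (I (p k) / h (p k)) else 0)"
      by (subst integral_mult_right_zero) (simp only:)
  qed
  also have "\<dots> = (\<Sum>p\<in>?S. \<Sum>k<N. (\<Prod>i<N. h i) * (I (p k) / h (p k)))"
  proof (intro sum.cong refl)
    fix p assume p: "p \<in> ?S"
    have "(\<Sum>q\<in>?S. \<Sum>k<N. signof p * signof q *
        (if p = q then (\<Prod>i<N. h i) * (I (p k) / h (p k)) else 0)) =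
      (\<Sum>q\<in>?S. if p = q then \<Sum>k<N. (\<Prod>i<N. h i) * (I (p k) / h (p k)) else (0::real))"
      by (intro sum.cong) (auto simp: sign_def)
    then show "(\<Sum>q\<in>?S. \<Sum>k<N. signof p * signof q *
        (if p = q then (\<Prod>i<N. h i) * (I (p k) / h (p k)) else 0)) =
      (\<Sum>k<N. (\<Prod>i<N. h i) * (I (p k) / h (p k)))"
      using p fin by simp
  qed
  also have "\<dots> = (\<Sum>p\<in>?S. (\<Prod>i<N. h i) * (\<Sum>i<N. I i / h i))"
  proof (intro sum.cong refl)
    \<comment> \<open>As the marked variable k varies, p k runs through all indices. Every
      permutation therefore contributes the same amount, whence the factor N!.\<close>
    fix p assume "p \<in> ?S"
    then have "(\<Sum>k<N. I (p k) / h (p k)) = (\<Sum>i<N. I i / h i)"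
      by (intro sum.reindex_bij_betw) (auto simp: permutes_imp_bij)
    then show "(\<Sum>k<N. (\<Prod>i<N. h i) * (I (p k) / h (p k))) = (\<Prod>i<N. h i) * (\<Sum>i<N. I i / h i)"
      by (simp only: sum_distrib_left[symmetric])
  qed
  also have "\<dots> = fact N * (\<Prod>i<N. h i) * (\<Sum>i<N. I i / h i)"
    by (simp add: card_permutations[of "{..<N}" N])
  finally show ?thesis
    by (simp add: I_def)
qed

subsection \<open>Moments of the ensemble\<close>

text \<open>\<open>erlang_density 1 l\<close> is l^2 x e^(-l x) on the half line, so y = l x has
  density y e^(-y). Here the algebraic functional meets Lebesgue integration and the scale N is
  absorbed.\<close>

lemma has_bochner_integral_erlang_poly:
  assumes l: "l > 0"
  shows "has_bochner_integral lborel (\<lambda>x. poly p (l * x) * erlang_density 1 l x)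
    (laguerre_functional p)"
proof -
  have mono: "has_bochner_integral lborel (\<lambda>x. coeff p i * (l * x) ^ i * erlang_density 1 l x)
      (coeff p i * fact (Suc i))" for i
  proof -
    have "has_bochner_integral lborel (\<lambda>x. erlang_density 1 l x * x ^ i) (fact (1 + i) / (fact 1 * l ^ i))"
    proof (rule has_bochner_integral_nn_integral)
      show "AE x in lborel. 0 \<le> erlang_density 1 l x * x ^ i"
        using l by (auto simp: erlang_density_def)
    qed (use nn_integral_erlang_ith_moment[OF l, of 1 i] l in auto)
    from has_bochner_integral_mult_right[OF this, of "coeff p i * l ^ i"]
    show ?thesis
      using l by (simp add: power_mult_distrib mult_ac)
  qed
  have "has_bochner_integral lborel
      (\<lambda>x. \<Sum>i\<le>degree p. coeff p i * (l * x) ^ i * erlang_density 1 l x)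
      (\<Sum>i\<le>degree p. coeff p i * fact (Suc i))"
    by (intro has_bochner_integral_sum mono)
  then show ?thesis
    by (simp add: laguerre_functional_def poly_altdef sum_distrib_right)
qed

lemma
  assumes "l > 0"
  shows integrable_erlang_poly: "integrable lborel (\<lambda>x. poly p (l * x) * erlang_density 1 l x)"
    and integral_erlang_poly:
      "(LINT x|lborel. poly p (l * x) * erlang_density 1 l x) = laguerre_functional p"
  using has_bochner_integral_erlang_poly[OF assms, of p] by (simp_all add: has_bochner_integral_iff)

text \<open>Passing from monomials in l_j to Laguerre polynomials in N l_j multiplies the
  Vandermonde product by \<open>a\<close>: the leading coefficients, and one N for each difference.
  Each density contributes a further N^2. If some l_j is negative, both sides vanish.\<close>

lemma laguerre_weight_eq_det:
  assumes "N \<ge> 1"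
  obtains K where "\<And>l. laguerre_weight N l = K *
    ((Determinant.det (mat N N (\<lambda>(j, i). poly (shifted_laguerre (Suc i)) (real N * l j))))\<^sup>2
     * (\<Prod>j<N. erlang_density 1 (real N) (l j)))"
proof -
  define a where "a = (\<Prod>i<N. coeff (shifted_laguerre (Suc i)) i) * (\<Prod>j<N. real N ^ j)"
  have a: "a \<noteq> 0"
    using assms degree_coeff_shifted_laguerre by (simp add: a_def)
  define K where "K = 1 / (a\<^sup>2 * (real N)\<^sup>2 ^ N)"
  have "laguerre_weight N l = K *
    ((Determinant.det (mat N N (\<lambda>(j, i). poly (shifted_laguerre (Suc i)) (real N * l j))))\<^sup>2
     * (\<Prod>j<N. erlang_density 1 (real N) (l j)))" for l
  proof (cases "\<forall>i<N. 0 \<le> l i")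
    case True
    have "(\<Prod>j<N. erlang_density 1 (real N) (l j)) =
        (\<Prod>j<N. (real N)\<^sup>2 * (l j * exp (- real N * l j)))"
      using True by (intro prod.cong) (auto simp: erlang_density_def power2_eq_square)
    then have rho: "(\<Prod>j<N. erlang_density 1 (real N) (l j)) =
        (real N)\<^sup>2 ^ N * (\<Prod>j<N. l j * exp (- real N * l j))"
      by (simp add: prod.distrib)
    have "Determinant.det (mat N N (\<lambda>(j, i). poly (shifted_laguerre (Suc i)) (real N * l j))) =
        (\<Prod>i<N. coeff (shifted_laguerre (Suc i)) i) * (\<Prod>j<N. \<Prod>i<j. real N * l j - real N * l i)"
      using degree_coeff_shifted_laguerre
      by (subst det_poly_mat) (auto simp: det_vandermonde)
    also have "\<dots> = a * (\<Prod>j<N. \<Prod>i<j. l j - l i)"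
      by (simp add: a_def right_diff_distrib[symmetric] prod.distrib)
    finally have "(Determinant.det (mat N N
        (\<lambda>(j, i). poly (shifted_laguerre (Suc i)) (real N * l j))))\<^sup>2 =
        a\<^sup>2 * (\<Prod>j<N. \<Prod>i<j. (l i - l j)\<^sup>2)"
      by (simp add: power_mult_distrib prod_power_distrib power2_commute)
    then show ?thesis
      unfolding rho using True a assms by (simp add: laguerre_weight_def K_def)
  next
    case False
    then obtain i where "i < N" "l i < 0"
      by force
    then have "(\<Prod>j<N. erlang_density 1 (real N) (l j)) = 0"
      by (auto simp: erlang_density_def)
    then show ?thesis
      using False by (auto simp: laguerre_weight_def)
  qed
  then show thesis
    using that by blast
qed

text \<open>The constant is obtained before \<open>n\<close> is chosen. Being common to all n, it
  can later be fixed at n = 0 instead of being matched with the normalization of the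
  ensemble.\<close>

lemma integral_laguerre_weight_power_sum:
  assumes N: "N \<ge> 1"
  obtains C where "\<And>n. (LINT l|Pi\<^sub>M {..<N} (\<lambda>_. lborel).
      laguerre_weight N l * (\<Sum>k<N. (real N * l k) ^ n)) = C * laguerre_trace_moment N n"
proof -
  obtain K where K: "\<And>l. laguerre_weight N l = K *
    ((Determinant.det (mat N N (\<lambda>(j, i). poly (shifted_laguerre (Suc i)) (real N * l j))))\<^sup>2
     * (\<Prod>j<N. erlang_density 1 (real N) (l j)))"
    using laguerre_weight_eq_det[OF N] by blast
  have pos: "real N > 0"
    using N by simp
  define \<phi> where "\<phi> i x = poly (shifted_laguerre (Suc i)) (real N * x)" for i x
  define \<rho> where "\<rho> = erlang_density 1 (real N)"
  define h :: "nat \<Rightarrow> real" where "h i = real (Suc i)" for i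
  have eq: "\<phi> a x * \<phi> b x * \<rho> x * (real N * x) ^ n = poly ([:0, 1:] ^ n *
      (shifted_laguerre (Suc a) * shifted_laguerre (Suc b))) (real N * x) * erlang_density 1 (real N) x"
    for a b x n
    by (simp add: \<phi>_def \<rho>_def)
  have mom: "integrable lborel (\<lambda>x. \<phi> a x * \<phi> b x * \<rho> x * (real N * x) ^ n)"
    "(LINT x|lborel. \<phi> a x * \<phi> b x * \<rho> x * (real N * x) ^ n) = laguerre_moment n (Suc a) (Suc b)"
    for a b n
    unfolding eq laguerre_moment_def
    by (rule integrable_erlang_poly[OF pos], rule integral_erlang_poly[OF pos])
  have "(LINT l|Pi\<^sub>M {..<N} (\<lambda>_. lborel).
      laguerre_weight N l * (\<Sum>k<N. (real N * l k) ^ n)) =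
      (K * (fact N * (\<Prod>i<N. h i))) * laguerre_trace_moment N n" for n
  proof -
    have "(LINT l|Pi\<^sub>M {..<N} (\<lambda>_. lborel).
        (Determinant.det (mat N N (\<lambda>(j, i). \<phi> i (l j))))\<^sup>2 * (\<Prod>j<N. \<rho> (l j))
        * (\<Sum>k<N. (real N * l k) ^ n)) =
        fact N * (\<Prod>i<N. h i) * (\<Sum>i<N. (LINT x|lborel. \<phi> i x * \<phi> i x * \<rho> x * (real N * x) ^ n) / h i)"
      using mom[of _ _ 0] mom[of _ _ n]
      by (intro integral_det_square) (auto simp: laguerre_form_eq h_def)
    then show ?thesis
      unfolding K \<phi>_def[symmetric] \<rho>_def[symmetric] mom(2) mult.assoc[of K] integral_mult_right_zero
      by (simp add: laguerre_trace_moment_def h_def)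
  qed
  then show thesis
    using that by blast
qed

text \<open>One power of N is the prefactor 1/N, the other n come from passing from N H back to
  H.\<close>

lemma laguerre_ensemble_moment:
  assumes N: "N \<ge> 1" and ens: "laguerre_ensemble N M H"
  shows "1 / of_nat N * (LINT \<omega>|M. mat_trace (H \<omega> ^\<^sub>m n)) =
    complex_of_real (laguerre_trace_moment N n / real N ^ Suc n)"
proof -
  interpret prob_space M
    using ens by (simp add: laguerre_ensemble_def)
  have carrier: "H \<omega> \<in> carrier_mat N N" if "\<omega> \<in> space M" for \<omega>
    using ens that by (auto simp: laguerre_ensemble_def)
  have H [measurable]: "(\<lambda>\<omega>. H \<omega> $$ (i, j)) \<in> borel_measurable M" if "i < N" "j < N" for i j
    using ens that by (auto simp: laguerre_ensemble_def)
  obtain lam c where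
    cp: "AE \<omega> in M. char_poly (H \<omega>) = (\<Prod>i<N. [:- complex_of_real (lam i \<omega>), 1:])"
    and dist: "distributed M (Pi\<^sub>M {..<N} (\<lambda>_. lborel)) (\<lambda>\<omega>. \<lambda>i\<in>{..<N}. lam i \<omega>)
      (\<lambda>l. ennreal (c * laguerre_weight N l))"
    using ens unfolding laguerre_ensemble_def by blast
  define X where "X \<omega> = (\<lambda>i\<in>{..<N}. lam i \<omega>)" for \<omega>
  define g :: "nat \<Rightarrow> (nat \<Rightarrow> real) \<Rightarrow> real" where "g n l = (\<Sum>k<N. (real N * l k) ^ n)" for n l
  have w: "laguerre_weight N l \<ge> 0" for l
    by (auto simp: laguerre_weight_def intro!: mult_nonneg_nonneg prod_nonneg)
  \<comment> \<open>\<open>ennreal\<close> truncates negative values to 0, so \<open>c\<close> may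
    be replaced by its positive part; this gives the nonnegative real density that
    \<open>distributed_integral\<close> asks for.\<close>
  have "ennreal (c * laguerre_weight N l) = ennreal (max 0 c * laguerre_weight N l)" for l
    using w[of l] by (cases "c \<ge> 0") (auto simp: max_def ennreal_neg mult_nonpos_nonneg)
  with dist have dist: "distributed M (Pi\<^sub>M {..<N} (\<lambda>_. lborel)) X
      (\<lambda>l. ennreal (max 0 c * laguerre_weight N l))"
    by (simp add: X_def[abs_def])
  have X [measurable]: "X \<in> measurable M (Pi\<^sub>M {..<N} (\<lambda>_. lborel))"
    using dist by (rule distributed_measurable)
  have g [measurable]: "g n \<in> borel_measurable (Pi\<^sub>M {..<N} (\<lambda>_. lborel))" for n
    unfolding g_def[abs_def] by measurable
  obtain C where C: "\<And>n. (LINT l|Pi\<^sub>M {..<N} (\<lambda>_. lborel). laguerre_weight N l * g n l) =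
      C * laguerre_trace_moment N n"
    unfolding g_def using integral_laguerre_weight_power_sum[OF N] by blast
  have E: "(LINT \<omega>|M. g n (X \<omega>)) = max 0 c * C * laguerre_trace_moment N n" for n
  proof -
    have "(LINT \<omega>|M. g n (X \<omega>)) =
        (LINT l|Pi\<^sub>M {..<N} (\<lambda>_. lborel). max 0 c * laguerre_weight N l * g n l)"
      using w by (intro distributed_integral[OF dist g, symmetric]) auto
    also have "\<dots> = max 0 c * C * laguerre_trace_moment N n"
      unfolding mult.assoc integral_mult_right_zero C ..
    finally show ?thesis .
  qed
  \<comment> \<open>At n = 0 the power sum is the constant N, which fixes the product of the two
    unknown constants.\<close>
  have "real N = max 0 c * C * real N"
    using E[of 0] by (simp add: g_def laguerre_trace_moment_0 prob_space)
  then have norm: "max 0 c * C = 1"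
    using N by simp
  \<comment> \<open>The trace is known to agree with the power sum only almost everywhere, so
    comparing the integrals calls for its own measurability, proved entrywise.\<close>
  have pow [measurable]: "(\<lambda>\<omega>. (H \<omega> ^\<^sub>m k) $$ (i, j)) \<in> borel_measurable M" if "i < N" "j < N" for i j k
    using that
  proof (induction k arbitrary: i j)
    case 0
    have "(\<lambda>\<omega>. (H \<omega> ^\<^sub>m 0) $$ (i, j)) \<in> borel_measurable M \<longleftrightarrow>
        (\<lambda>\<omega>. if i = j then 1 else 0 :: complex) \<in> borel_measurable M"
    proof (intro measurable_cong)
      fix \<omega> assume "\<omega> \<in> space M"
      then have "H \<omega> \<in> carrier_mat N N"
        by (rule carrier)
      then show "(H \<omega> ^\<^sub>m 0) $$ (i, j) = (if i = j then 1 else 0)"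
        using 0 by simp
    qed
    then show ?case
      by simp
  next
    case (Suc k)
    have "(\<lambda>\<omega>. (H \<omega> ^\<^sub>m Suc k) $$ (i, j)) \<in> borel_measurable M \<longleftrightarrow>
        (\<lambda>\<omega>. \<Sum>l<N. (H \<omega> ^\<^sub>m k) $$ (i, l) * H \<omega> $$ (l, j)) \<in> borel_measurable M"
    proof (intro measurable_cong)
      fix \<omega> assume "\<omega> \<in> space M"
      then have "H \<omega> \<in> carrier_mat N N"
        by (rule carrier)
      then show "(H \<omega> ^\<^sub>m Suc k) $$ (i, j) = (\<Sum>l<N. (H \<omega> ^\<^sub>m k) $$ (i, l) * H \<omega> $$ (l, j))"
        using Suc.prems by (simp add: scalar_prod_def atLeast0LessThan)
    qed
    then show ?case
      using Suc by (auto intro!: borel_measurable_sum borel_measurable_times H)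
  qed
  have "(\<lambda>\<omega>. mat_trace (H \<omega> ^\<^sub>m n)) \<in> borel_measurable M \<longleftrightarrow>
      (\<lambda>\<omega>. \<Sum>i<N. (H \<omega> ^\<^sub>m n) $$ (i, i)) \<in> borel_measurable M"
  proof (intro measurable_cong)
    fix \<omega> assume "\<omega> \<in> space M"
    then have "H \<omega> \<in> carrier_mat N N"
      by (rule carrier)
    then show "mat_trace (H \<omega> ^\<^sub>m n) = (\<Sum>i<N. (H \<omega> ^\<^sub>m n) $$ (i, i))"
      by (simp add: mat_trace_def)
  qed
  then have meas: "(\<lambda>\<omega>. mat_trace (H \<omega> ^\<^sub>m n)) \<in> borel_measurable M"
    using pow by (auto intro!: borel_measurable_sum)
  have tr: "AE \<omega> in M. mat_trace (H \<omega> ^\<^sub>m n) = complex_of_real (g n (X \<omega>) / real N ^ n)"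
    using cp
  proof (rule AE_mp, intro AE_I2 impI)
    fix \<omega> assume "\<omega> \<in> space M" "char_poly (H \<omega>) = (\<Prod>i<N. [:- complex_of_real (lam i \<omega>), 1:])"
    then have "mat_trace (H \<omega> ^\<^sub>m n) = (\<Sum>i<N. complex_of_real (lam i \<omega>) ^ n)"
      by (intro mat_trace_pow carrier)
    then show "mat_trace (H \<omega> ^\<^sub>m n) = complex_of_real (g n (X \<omega>) / real N ^ n)"
      using N by (simp add: g_def X_def power_mult_distrib sum_distrib_left[symmetric])
  qed
  have "(LINT \<omega>|M. mat_trace (H \<omega> ^\<^sub>m n)) = (LINT \<omega>|M. complex_of_real (g n (X \<omega>) / real N ^ n))"
    using tr by (intro integral_cong_AE meas) auto
  also have "\<dots> = complex_of_real (laguerre_trace_moment N n / real N ^ n)"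
    unfolding integral_complex_of_real by (simp add: E norm)
  finally show ?thesis
    by (simp add: divide_inverse)
qed

subsection \<open>The differential equation\<close>

lemma ser_D_nth': "fls_nth (ser_D F) k = - of_int (k - 1) * fls_nth F (k - 1)"
  using ser_D_nth[of F "k - 1"] by simp

text \<open>Let R_n have leading term (n + 2) m_(n+1), and let moments of negative index be 0. Then
  R_n = 0 fails only for R_(-1) = 1 and R_0 = 1/N. These defects are the right-hand side: (2 N^2 +
  N) R_(-1) at x^0, and (2 N^2 + N) R_0 + R_(-1) = 2 N + 2 at 1/x.\<close>

lemma laguerre_series_ode:
  fixes N :: nat and m :: "nat \<Rightarrow> complex"
  assumes N: "N \<ge> 1" and m0: "m 0 = 1" and m1: "m (Suc 0) = 1 + 1 / of_nat N"
    and rec: "\<And>n. (of_nat n + 3) * m (Suc (Suc n)) =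
      (2 + 1 / of_nat N) * (2 * of_nat n + 3) * m (Suc n)
      + (of_nat n)\<^sup>2 * (of_nat n + 2) / (of_nat N)\<^sup>2 * m n"
  shows "let x = ser_x; D = ser_D; n = of_nat N; W = fls_X * fps_to_fls (Abs_fps m) in
       n\<^sup>2 * ((- 2 * x\<^sup>2 + 8 * x) * D W + 4 * W)
       + n * ((- x\<^sup>2 + 8 * x) * D W + 4 * W)
       + (2 * x\<^sup>2 * (D ^^ 3) W + (- x\<^sup>2 + 12 * x) * (D ^^ 2) W + (- x + 12) * D W + W)
       + 1 / n * (x\<^sup>2 * (D ^^ 3) W + 6 * x * (D ^^ 2) W + 6 * D W)
       + 1 / n\<^sup>2 * (x\<^sup>2 * (D ^^ 4) W + 7 * x * (D ^^ 3) W + 9 * (D ^^ 2) W)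
       = 2 * n\<^sup>2 + n + (2 * n + 2) / x"
proof -
  define W where "W = fls_X * fps_to_fls (Abs_fps m)"
  define w where "w = fls_nth W"
  have w_pos: "w (int n + 1) = m n" for n
    unfolding w_def W_def by (simp add: fls_X_times_conv_shift)
  have w_neg: "w k = 0" if "k \<le> 0" for k
    using that unfolding w_def W_def by (simp add: fls_X_times_conv_shift)
  define v :: complex where "v = of_nat N"
  have v: "v \<noteq> 0"
    using N by (simp add: v_def)
  \<comment> \<open>1/N becomes an unknown of its own, tied to \<open>v\<close> by
    \<open>uv\<close>, so that the coefficient identities are polynomial and fall to Groebner
    bases.\<close>
  define u where "u = 1 / v"
  have uv: "u * v = 1"
    using v by (simp add: u_def)
  have n: "of_nat N = fls_const v"
    by (simp add: v_def fls_of_nat)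
  have inv: "1 / fls_const v = fls_const u" "1 / (fls_const v)\<^sup>2 = fls_const (u\<^sup>2)"
    using v by (simp_all add: u_def divide_inverse fls_inverse_const power_inverse flip: fls_const_power)
  \<comment> \<open>Coefficient k of \<open>W\<close> is the moment of index k - 1; instance n of
    the recurrence sits at k = n + 2.\<close>
  have w_rec: "(of_int k + 1) * w (k + 1) =
      (2 + u) * (2 * of_int k - 1) * w k + (of_int k - 2)\<^sup>2 * of_int k * u\<^sup>2 * w (k - 1)"
    if "k \<ge> 2" for k
  proof -
    define n where "n = nat (k - 2)"
    have k: "k = int n + 2"
      using that by (simp add: n_def)
    have "w (k + 1) = m (Suc (Suc n))" "w k = m (Suc n)" "w (k - 1) = m n"
      using w_pos[of n] w_pos[of "Suc n"] w_pos[of "Suc (Suc n)"] by (simp_all add: k add_ac)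
    then show ?thesis
      using rec[of n] unfolding k u_def v_def by (simp add: algebra_simps power_one_over add_divide_distrib)
  qed
  \<comment> \<open>The coefficient of x^(-k) in the equation. In the N^(-2) part the three terms
    share (k - 1) (k - 2), and (k + 1) k - 7 k + 9 collapses to (k - 3)^2.\<close>
  have coeff: "v\<^sup>2 * (2 * (of_int k + 1) * w (k + 1) - 8 * of_int k * w k + 4 * w k)
      + v * ((of_int k + 1) * w (k + 1) - 8 * of_int k * w k + 4 * w k)
      + (- (of_int k - 1) * (of_int k + 1) * w k
         - 2 * (of_int k - 1) * (of_int k - 2) * (of_int k - 3) * w (k - 1))
      + u * (- (of_int k - 1) * (of_int k - 2) * (of_int k - 3) * w (k - 1))
      + u\<^sup>2 * ((of_int k - 1) * (of_int k - 2) * (of_int k - 3)\<^sup>2 * w (k - 2))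
      = (if k = 0 then 2 * v\<^sup>2 + v else if k = 1 then 2 * v + 2 else 0)" (is "?L k = _") for k
  proof -
    consider "k < 0" | "k = 0" | "k = 1" | "k \<ge> 2"
      by linarith
    then show ?thesis
    proof cases
      case 1
      then show ?thesis
        by (simp add: w_neg)
    next
      case 2
      then show ?thesis
        using w_pos[of 0] by (simp add: w_neg m0)
    next
      case 3
      have "w 1 = 1" "w 2 = 1 + u"
        using w_pos[of 0] w_pos[of 1] m0 m1 by (simp_all add: u_def v_def)
      moreover have "v\<^sup>2 * (4 * u) + v * (2 * u - 2) = 2 * v + 2"
        using uv by Groebner_Basis.algebra
      ultimately show ?thesis
        using 3 by (simp add: w_neg)
    next
      case 4
      define K :: complex where "K = of_int k"
      have "(K + 1) * w (k + 1) = (2 + u) * (2 * K - 1) * w k + (K - 2)\<^sup>2 * K * u\<^sup>2 * w (k - 1)"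
        using w_rec[of k] 4 unfolding K_def by simp
      \<comment> \<open>The multiplier K - 2 stays on both sides because the earlier instance of the
        recurrence fails at k = 2, where it would read 2 w 2 = 2 + u although w 2 = 1 + u. The
        multiplier vanishes exactly there.\<close>
      moreover have "(K - 2) * (K * w k) = (K - 2) *
          ((2 + u) * (2 * K - 3) * w (k - 1) + (K - 3)\<^sup>2 * (K - 1) * u\<^sup>2 * w (k - 2))"
      proof (cases "k = 2")
        case False
        then have "K * w k =
            (2 + u) * (2 * K - 3) * w (k - 1) + (K - 3)\<^sup>2 * (K - 1) * u\<^sup>2 * w (k - 2)"
          using w_rec[of "k - 1"] 4 unfolding K_def by (simp add: algebra_simps)
        then show ?thesis
          by (simp only:)
      qed (simp add: K_def)
      ultimately have "?L k = 0"
        using uv unfolding K_def[symmetric] by Groebner_Basis.algebra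
      then show ?thesis
        using 4 by simp
    qed
  qed
  show ?thesis
    unfolding Let_def W_def[symmetric] n inv
  proof (rule fls_eqI)
    fix k
    have x: "fls_nth (ser_x * F) j = fls_nth F (j + 1)"
      and x2: "fls_nth (ser_x\<^sup>2 * F) j = fls_nth F (j + 2)" for F and j :: int
      by (simp_all add: fls_X_inv_power_times_conv_shift fls_X_inv_times_conv_shift)
    have D: "(ser_D ^^ 2) W = ser_D (ser_D W)" "(ser_D ^^ 3) W = ser_D (ser_D (ser_D W))"
      "(ser_D ^^ 4) W = ser_D (ser_D (ser_D (ser_D W)))"
      by (simp_all add: eval_nat_numeral)
    have rhs: "fls_nth (2 * fls_const (v\<^sup>2) + fls_const v + (2 * fls_const v + 2) / ser_x) k
        = (if k = 0 then 2 * v\<^sup>2 + v else if k = 1 then 2 * v + 2 else 0)"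
      by simp
    show "fls_nth ((fls_const v)\<^sup>2 * ((- 2 * ser_x\<^sup>2 + 8 * ser_x) * ser_D W + 4 * W)
       + fls_const v * ((- ser_x\<^sup>2 + 8 * ser_x) * ser_D W + 4 * W)
       + (2 * ser_x\<^sup>2 * (ser_D ^^ 3) W + (- ser_x\<^sup>2 + 12 * ser_x) * (ser_D ^^ 2) W + (- ser_x + 12) * ser_D W + W)
       + fls_const u * (ser_x\<^sup>2 * (ser_D ^^ 3) W + 6 * ser_x * (ser_D ^^ 2) W + 6 * ser_D W)
       + fls_const (u\<^sup>2) * (ser_x\<^sup>2 * (ser_D ^^ 4) W + 7 * ser_x * (ser_D ^^ 3) W + 9 * (ser_D ^^ 2) W)) k
       = fls_nth (2 * (fls_const v)\<^sup>2 + fls_const v + (2 * fls_const v + 2) / ser_x) k"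
      unfolding fls_const_power[symmetric] rhs D coeff[of k, symmetric]
      by (simp only: distrib_right mult.assoc mult_minus_left x x2 fls_plus_nth fls_uminus_nth
          fls_mult_of_numeral_nth fls_mult_const_nth ser_D_nth' w_def[symmetric])
        (simp add: algebra_simps power2_eq_square)
  qed
qed

theorem corollary1:
  fixes N :: nat and M :: "'a measure" and H :: "'a \<Rightarrow> complex mat"
  assumes "N \<ge> 1" and "laguerre_ensemble N M H"
  shows
    "let x = ser_x; D = ser_D; n = of_nat N; W = W1 N M H in
       n\<^sup>2 * ((- 2 * x\<^sup>2 + 8 * x) * D W + 4 * W)
       + n * ((- x\<^sup>2 + 8 * x) * D W + 4 * W)
       + (2 * x\<^sup>2 * (D ^^ 3) W + (- x\<^sup>2 + 12 * x) * (D ^^ 2) W + (- x + 12) * D W + W)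
       + 1 / n * (x\<^sup>2 * (D ^^ 3) W + 6 * x * (D ^^ 2) W + 6 * D W)
       + 1 / n\<^sup>2 * (x\<^sup>2 * (D ^^ 4) W + 7 * x * (D ^^ 3) W + 9 * (D ^^ 2) W)
       = 2 * n\<^sup>2 + n + (2 * n + 2) / x"
proof -
  define m where "m n = complex_of_real (laguerre_trace_moment N n / real N ^ Suc n)" for n
  have N: "real N \<noteq> 0" "complex_of_nat N \<noteq> 0"
    using assms(1) by auto
  have W: "W1 N M H = fls_X * fps_to_fls (Abs_fps m)"
    unfolding W1_def m_def[abs_def] laguerre_ensemble_moment[OF assms] ..
  have "m 0 = 1"
    using N by (simp add: m_def laguerre_trace_moment_0)
  moreover have "m (Suc 0) = 1 + 1 / of_nat N"
    using N by (simp add: m_def laguerre_trace_moment_1 field_simps)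
  moreover have "(of_nat n + 3) * m (Suc (Suc n)) =
      (2 + 1 / of_nat N) * (2 * of_nat n + 3) * m (Suc n)
      + (of_nat n)\<^sup>2 * (of_nat n + 2) / (of_nat N)\<^sup>2 * m n" for n
  proof -
    define \<mu> where "\<mu> k = laguerre_trace_moment N k / real N ^ Suc k" for k
    have pm: "laguerre_trace_moment N k = \<mu> k * real N ^ Suc k" for k
      using N by (simp add: \<mu>_def)
    \<comment> \<open>In terms of \<mu> the power N^(n+3) is common: 2 N + 1 leaves 2 + 1/N, and the
      last term is two powers of N short.\<close>
    have "real N ^ Suc (Suc (Suc n)) * ((real n + 3) * \<mu> (Suc (Suc n))) =
      real N ^ Suc (Suc (Suc n)) * ((2 + 1 / real N) * (2 * real n + 3) * \<mu> (Suc n)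
      + (real n)\<^sup>2 * (real n + 2) / (real N)\<^sup>2 * \<mu> n)"
      using laguerre_trace_moment_rec[of n N] N unfolding pm
      by (simp add: field_simps power2_eq_square)
    then have rec: "(real n + 3) * \<mu> (Suc (Suc n)) =
      (2 + 1 / real N) * (2 * real n + 3) * \<mu> (Suc n)
      + (real n)\<^sup>2 * (real n + 2) / (real N)\<^sup>2 * \<mu> n"
      using N by (subst (asm) mult_cancel_left) simp
    have "m k = complex_of_real (\<mu> k)" for k
      by (simp only: m_def \<mu>_def)
    then show ?thesis
      using arg_cong[OF rec, of complex_of_real] by simp
  qed
  ultimately show ?thesis
    unfolding W using assms(1) by (intro laguerre_series_ode)
qed

end
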